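(* Let $\alpha: I\to E_1^3$ be a non-lightlike curve and let $\beta$ be a Mannheim-direction curve of $\alpha$. Then the following are equivalent: (i) $\alpha$ is a helix. (ii) $\alpha$ is a Mannheim-donor curve of a slant helix. (iii) A Mannheim-direction curve of $\alpha$ is a slant helix.
   Context: $E_1^3$ is $\mathbb{R}^3$ with the metric $\langle x,y\rangle=-x_1y_1+x_2y_2+x_3y_3$ and the Lorentz vector product $x\times y=(x_2y_3-x_3y_2,\ x_1y_3-x_3y_1,\ x_2y_1-x_1y_2)$. A vector $x$ is spacelike if $\langle x,x\rangle>0$ or $x=0$, timelike if $\langle x,x\rangle<0$, lightlike if $\langle x,x\rangle=0$ and $x\ne0$. A curve is timelike (spacelike) if all its velocity vectors are; non-lightlike means timelike or spacelike; unit speed means $|\langle\alpha',\alpha'\rangle|=1$. All curves are unit speed Frenet curves, as differentiable as needed. A unit speed non-lightlike curve $\alpha(s)$ has Frenet frame $\{T,N,B\}$ (orthonormal, non-lightlike vectors, $T=\alpha'$), curvature $\kappa$ and torsion $\tau$ with $T'=\kappa N,\ N'=\varepsilon_B\kappa T+\tau B,\ B'=\varepsilon_T\tau N$, where $\varepsilon_Y=\langle Y,Y\rangle=\pm1$ and $\varepsilon_B=-\varepsilon_T\varepsilon_N$; the frame satisfies $B=\varepsilon_T\varepsilon_N T\times N$, $N=\varepsilon_B\varepsilon_T B\times T$, $T=\varepsilon_N\varepsilon_B N\times B$. It is a Frenet curve if $\kappa\neq0$. A spacelike curve is of type 1 if $N$ is timelike (and $T,B$ spacelike), of type 2 if $B$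 is timelike (and $T,N$ spacelike). Let $X=uT+vN+wB$ with $u,v,w$ differentiable and $\varepsilon_Tu^2+\varepsilon_Nv^2+\varepsilon_Bw^2=\pm1$ (constant sign). An $X$-direction curve of $\alpha$ is a curve $\beta$ with tangent $\overline T=X$; $s$ is also arc-length for $\beta$. The Frenet frame, curvature and torsion of $\beta$ are $\{\overline T,\overline N,\overline B\},\overline\kappa,\overline\tau$, with $\overline\kappa\ne0$. $\beta$ is a Mannheim-direction curve of $\alpha$, and $\alpha$ a Mannheim-donor curve of $\beta$, if $\beta$ is an $X$-direction curve of $\alpha$ and a Mannheim curve of $\alpha$ with $\alpha$ its Mannheim partner curve (i.e. $\overline N=B$); explicitly, $X$ is: $-\cosh(\int\kappa ds)T+\sinh(\int\kappa ds)N$ if $\alpha$ is timelike (resp. spacelike of type 1) and $X$ timelike (resp. spacelike); $\sinh(\int\kappa ds)T-\cosh(\int\kappa ds)N$ if $\alpha$ is timelike (resp. spacelike of type 1) and $X$ spacelike (resp. timelike); $-\cos(\int\kappa ds)T+\sin(\int\kappa ds)N$ if $\alpha$ is spacelike of type 2 and $X$ spacelike, with $\int\kappa\,ds$ an antiderivative of $\kappa$. A (general) helix is a curve for which the ratio of its non-zero curvature to its non-zero torsion is a constant function. A slant helix is a curve whose principal normal vectors make a constant angle with a fixed line (i.e. $\langle N,U\rangle$ is constant for some fixed vector $U\neq0$); the characterization used is that $\frac{\kappa^2}{(\tau^2-\kappa^2)^{3/2}}\left(\frac{\tau}{\kappa}\right)'$ or $\frac{\kappa^2}{(\kappa^2\pm\tau^2)^{3/2}}\left(\frac{\tau}{\kappa}\right)'$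 is constant. *)

theory Defs
  imports "HOL-Analysis.Analysis"
begin

definition minkowski_inner :: "real^3 \<Rightarrow> real^3 \<Rightarrow> real"  ("\<langle>_,/ _\<rangle>")
  where "\<langle>x, y\<rangle> = - x$1 * y$1 + x$2 * y$2 + x$3 * y$3"

definition lorentz_cross :: "real^3 \<Rightarrow> real^3 \<Rightarrow> real^3"  (infixr "\<times>\<^sub>L" 80)
  where "x \<times>\<^sub>L y = vector [x$2 * y$3 - x$3 * y$2, x$1 * y$3 - x$3 * y$1, x$2 * y$1 - x$1 * y$2]"

definition spacelike :: "real^3 \<Rightarrow> bool"
  where "spacelike x \<longleftrightarrow> \<langle>x, x\<rangle> > 0 \<or> x = 0"

definition timelike :: "real^3 \<Rightarrow> bool"
  where "timelike x \<longleftrightarrow> \<langle>x, x\<rangle> < 0"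

text \<open>A curve is a function on \<^term>\<open>I :: real set\<close>; only its values on \<open>I\<close> matter, so derivatives
  are taken within \<open>I\<close> (one-sided at an endpoint belonging to \<open>I\<close>).\<close>

definition velocity :: "real set \<Rightarrow> (real \<Rightarrow> real^3) \<Rightarrow> real \<Rightarrow> real^3"
  where "velocity I \<alpha> s = vector_derivative \<alpha> (at s within I)"

definition non_lightlike_curve :: "real set \<Rightarrow> (real \<Rightarrow> real^3) \<Rightarrow> bool"
  where "non_lightlike_curve I \<alpha> \<longleftrightarrow> \<alpha> differentiable_on I \<and>
    ((\<forall>s\<in>I. timelike (velocity I \<alpha> s)) \<or> (\<forall>s\<in>I. spacelike (velocity I \<alpha> s)))"

definition unit_speed_curve :: "real set \<Rightarrow> (real \<Rightarrow> real^3) \<Rightarrow> bool"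
  where "unit_speed_curve I \<alpha> \<longleftrightarrow> \<alpha> differentiable_on I \<and>
    (\<forall>s\<in>I. \<bar>\<langle>velocity I \<alpha> s, velocity I \<alpha> s\<rangle>\<bar> = 1)"

record frenet_apparatus =
  tangent :: "real \<Rightarrow> real^3"
  normal :: "real \<Rightarrow> real^3"
  binormal :: "real \<Rightarrow> real^3"
  curvature :: "real \<Rightarrow> real"
  torsion :: "real \<Rightarrow> real"

text \<open>The curvature is only required to be non-zero, not positive.  Hence the apparatus of a curve
  is determined up to the simultaneous sign change of normal, binormal and curvature; the notions
  below quantify existentially over it and do not depend on this choice.\<close>

definition is_frenet_apparatus :: "real set \<Rightarrow> (real \<Rightarrow> real^3) \<Rightarrow> frenet_apparatus \<Rightarrow> bool"
  where "is_frenet_apparatus I \<alpha> F \<longleftrightarrow>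
    (\<exists>\<epsilon>T\<in>{1, -1}. \<exists>\<epsilon>N\<in>{1, -1}. \<exists>\<epsilon>B\<in>{1, -1}. \<forall>s\<in>I.
      (let T = tangent F; N = normal F; B = binormal F; \<kappa> = curvature F s; \<tau> = torsion F s in
        \<langle>T s, T s\<rangle> = \<epsilon>T \<and> \<langle>N s, N s\<rangle> = \<epsilon>N \<and> \<langle>B s, B s\<rangle> = \<epsilon>B \<and>
        \<langle>T s, N s\<rangle> = 0 \<and> \<langle>T s, B s\<rangle> = 0 \<and> \<langle>N s, B s\<rangle> = 0 \<and>
        B s = (\<epsilon>T * \<epsilon>N) *\<^sub>R (T s \<times>\<^sub>L N s) \<and>
        N s = (\<epsilon>B * \<epsilon>T) *\<^sub>R (B s \<times>\<^sub>L T s) \<and>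
        T s = (\<epsilon>N * \<epsilon>B) *\<^sub>R (N s \<times>\<^sub>L B s) \<and>
        (\<alpha> has_vector_derivative T s) (at s within I) \<and>
        (T has_vector_derivative \<kappa> *\<^sub>R N s) (at s within I) \<and>
        (N has_vector_derivative (\<epsilon>B * \<kappa>) *\<^sub>R T s + \<tau> *\<^sub>R B s) (at s within I) \<and>
        (B has_vector_derivative (\<epsilon>T * \<tau>) *\<^sub>R N s) (at s within I) \<and>
        \<kappa> \<noteq> 0))"

definition frenet_curve :: "real set \<Rightarrow> (real \<Rightarrow> real^3) \<Rightarrow> bool"
  where "frenet_curve I \<alpha> \<longleftrightarrow> unit_speed_curve I \<alpha> \<and> non_lightlike_curve I \<alpha> \<and>
    (\<exists>F. is_frenet_apparatus I \<alpha> F)"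

definition general_helix :: "real set \<Rightarrow> (real \<Rightarrow> real^3) \<Rightarrow> bool"
  where "general_helix I \<alpha> \<longleftrightarrow> frenet_curve I \<alpha> \<and>
    (\<exists>F. is_frenet_apparatus I \<alpha> F \<and> (\<forall>s\<in>I. torsion F s \<noteq> 0) \<and>
      (\<exists>c. \<forall>s\<in>I. curvature F s / torsion F s = c))"

definition slant_helix :: "real set \<Rightarrow> (real \<Rightarrow> real^3) \<Rightarrow> bool"
  where "slant_helix I \<alpha> \<longleftrightarrow> frenet_curve I \<alpha> \<and>
    (\<exists>F. is_frenet_apparatus I \<alpha> F \<and>
      (\<exists>U. U \<noteq> 0 \<and> (\<exists>c. \<forall>s\<in>I. \<langle>normal F s, U\<rangle> = c)))"

definition unit_frame_field :: "real set \<Rightarrow> frenet_apparatus \<Rightarrow> (real \<Rightarrow> real^3) \<Rightarrow> bool"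
  where "unit_frame_field I F X \<longleftrightarrow>
    (let T = tangent F; N = normal F; B = binormal F in
      \<exists>u v w. u differentiable_on I \<and> v differentiable_on I \<and> w differentiable_on I \<and>
        (\<forall>s\<in>I. X s = u s *\<^sub>R T s + v s *\<^sub>R N s + w s *\<^sub>R B s) \<and>
        (\<exists>\<epsilon>\<in>{1, -1}. \<forall>s\<in>I.
          \<langle>T s, T s\<rangle> * (u s)\<^sup>2 + \<langle>N s, N s\<rangle> * (v s)\<^sup>2 + \<langle>B s, B s\<rangle> * (w s)\<^sup>2 = \<epsilon>))"

definition direction_curve ::
    "real set \<Rightarrow> frenet_apparatus \<Rightarrow> (real \<Rightarrow> real^3) \<Rightarrow> (real \<Rightarrow> real^3) \<Rightarrow> bool"
  where "direction_curve I F X \<beta> \<longleftrightarrow> unit_frame_field I F X \<and>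
    (\<forall>s\<in>I. (\<beta> has_vector_derivative X s) (at s within I))"

text \<open>Since \<open>X' = (u' + \<epsilon>\<^sub>B \<kappa> v) T + (v' + \<kappa> u + \<epsilon>\<^sub>T \<tau> w) N + (w' + \<tau> v) B\<close> and the normal of \<open>\<beta>\<close>
  is \<open>B\<close>, the definition below forces \<open>w = 0\<close>, \<open>u' = - \<epsilon>\<^sub>B \<kappa> v\<close> and \<open>v' = - \<kappa> u\<close>; solving this gives
  \<open>- cosh (\<integral>\<kappa>) T + sinh (\<integral>\<kappa>) N\<close>, \<open>sinh (\<integral>\<kappa>) T - cosh (\<integral>\<kappa>) N\<close> or \<open>- cos (\<integral>\<kappa>) T + sin (\<integral>\<kappa>) N\<close>
  according to the causal characters, up to the overall sign of \<open>X\<close>.  The curvature of \<open>\<beta>\<close> is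
  then \<open>\<tau> v\<close>.\<close>

definition mannheim_direction_curve ::
    "real set \<Rightarrow> (real \<Rightarrow> real^3) \<Rightarrow> (real \<Rightarrow> real^3) \<Rightarrow> bool"
  where "mannheim_direction_curve I \<alpha> \<beta> \<longleftrightarrow> frenet_curve I \<alpha> \<and> frenet_curve I \<beta> \<and>
    (\<exists>F G X. is_frenet_apparatus I \<alpha> F \<and> is_frenet_apparatus I \<beta> G \<and>
      direction_curve I F X \<beta> \<and> (\<forall>s\<in>I. normal G s = binormal F s))"

definition mannheim_donor_curve ::
    "real set \<Rightarrow> (real \<Rightarrow> real^3) \<Rightarrow> (real \<Rightarrow> real^3) \<Rightarrow> bool"
  where "mannheim_donor_curve I \<beta> \<alpha> \<longleftrightarrow> mannheim_direction_curve I \<alpha> \<beta>"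

end

(* If U makes a constant angle with the binormal B of \<alpha>, differentiating twice gives
   \<langle>N, U\<rangle> = 0, hence \<langle>T, U\<rangle> is constant and \<epsilon>B \<kappa> \<langle>T, U\<rangle> = - \<tau> \<langle>B, U\<rangle>, so \<kappa> / \<tau> is constant.
   Conversely, if \<kappa> / \<tau> = c then B - (\<epsilon>T / c) T is a fixed vector of constant angle with B.
   As B is the principal normal of every Mannheim-direction curve \<beta> of \<alpha>, this is the slant
   condition for \<beta>; moreover \<tau> \<noteq> 0, since otherwise B' = 0 contradicts the curvature of \<beta> being
   non-zero.  Frenet apparatuses of the same curve differ by a global sign. *)

theory Submission
  imports Defs
begin

section \<open>Algebra of the Lorentz metric and vector product\<close>

lemma minkowski_inner_commute: "\<langle>x, y\<rangle> = \<langle>y, x\<rangle>"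
  by (simp add: minkowski_inner_def)

text \<open>The metric is the Euclidean inner product precomposed with the reflection of the first
  coordinate. Bilinearity then yields its rules for sums, limits and derivatives.\<close>

lemma bounded_bilinear_minkowski_inner: "bounded_bilinear minkowski_inner"
proof -
  have eq: "minkowski_inner = (\<lambda>x y. inner (\<chi> i. if i = 1 then - x$1 else x$i) y)"
    by (simp add: fun_eq_iff minkowski_inner_def inner_vec_def sum_3)
  have "bounded_linear (\<lambda>x::real^3. \<chi> i::3. if i = 1 then - x$1 else x$i)"
    by (intro linear_conv_bounded_linear[THEN iffD1] linearI) (simp_all add: vec_eq_iff)
  then show ?thesis
    unfolding eq by (rule bounded_bilinear.comp1[OF bounded_bilinear_inner])
qed

interpretation minkowski: bounded_bilinear minkowski_inner
  by (rule bounded_bilinear_minkowski_inner)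

lemma lorentz_cross_scaleR_right: "x \<times>\<^sub>L (c *\<^sub>R y) = c *\<^sub>R (x \<times>\<^sub>L y)"
  by (simp add: lorentz_cross_def vec_eq_iff forall_3 algebra_simps)

text \<open>Cramer's rule: up to the triple product, the cross products form the basis dual to
  \<open>a\<close>, \<open>b\<close>, \<open>c\<close>.\<close>

lemma triple_product_expansion:
  "\<langle>a \<times>\<^sub>L b, c\<rangle> *\<^sub>R x = \<langle>x, a\<rangle> *\<^sub>R (b \<times>\<^sub>L c) + \<langle>x, b\<rangle> *\<^sub>R (c \<times>\<^sub>L a) + \<langle>x, c\<rangle> *\<^sub>R (a \<times>\<^sub>L b)"
  by (simp add: lorentz_cross_def minkowski_inner_def vec_eq_iff forall_3 algebra_simps)

section \<open>Frenet frames at a point\<close>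

lemma frenet_apparatus_elim:
  assumes "is_frenet_apparatus I \<alpha> F"
  obtains \<epsilon>T \<epsilon>N \<epsilon>B :: real where
    "\<epsilon>T \<in> {1, -1}" "\<epsilon>N \<in> {1, -1}" "\<epsilon>B \<in> {1, -1}"
    "\<And>s. s \<in> I \<Longrightarrow> \<langle>tangent F s, tangent F s\<rangle> = \<epsilon>T"
    "\<And>s. s \<in> I \<Longrightarrow> \<langle>normal F s, normal F s\<rangle> = \<epsilon>N"
    "\<And>s. s \<in> I \<Longrightarrow> \<langle>binormal F s, binormal F s\<rangle> = \<epsilon>B"
    "\<And>s. s \<in> I \<Longrightarrow> \<langle>tangent F s, normal F s\<rangle> = 0"
    "\<And>s. s \<in> I \<Longrightarrow> \<langle>tangent F s, binormal F s\<rangle> = 0"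
    "\<And>s. s \<in> I \<Longrightarrow> \<langle>normal F s, binormal F s\<rangle> = 0"
    "\<And>s. s \<in> I \<Longrightarrow> binormal F s = (\<epsilon>T * \<epsilon>N) *\<^sub>R (tangent F s \<times>\<^sub>L normal F s)"
    "\<And>s. s \<in> I \<Longrightarrow> (\<alpha> has_vector_derivative tangent F s) (at s within I)"
    "\<And>s. s \<in> I \<Longrightarrow> (tangent F has_vector_derivative curvature F s *\<^sub>R normal F s) (at s within I)"
    "\<And>s. s \<in> I \<Longrightarrow> (normal F has_vector_derivative
        (\<epsilon>B * curvature F s) *\<^sub>R tangent F s + torsion F s *\<^sub>R binormal F s) (at s within I)"
    "\<And>s. s \<in> I \<Longrightarrow>
        (binormal F has_vector_derivative (\<epsilon>T * torsion F s) *\<^sub>R normal F s) (at s within I)"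
    "\<And>s. s \<in> I \<Longrightarrow> curvature F s \<noteq> 0"
  using assms unfolding is_frenet_apparatus_def Let_def
  by (elim bexE) (rule that; (assumption | (drule (1) bspec, elim conjE, assumption)))

text \<open>The frame is a basis: its triple product is nonzero because the binormal is a multiple
  of the cross product of tangent and normal and is not null. The expansion above then kills
  \<open>U\<close>.\<close>

lemma frenet_frame_orthogonal_imp_0:
  assumes F: "is_frenet_apparatus I \<alpha> F" and s: "s \<in> I"
    and orth: "\<langle>tangent F s, U\<rangle> = 0" "\<langle>normal F s, U\<rangle> = 0" "\<langle>binormal F s, U\<rangle> = 0"
  shows "U = 0"
proof (rule frenet_apparatus_elim[OF F])
  fix \<epsilon>T \<epsilon>N \<epsilon>B :: real
  assume \<epsilon>: "\<epsilon>B \<in> {1, -1}"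
    and "\<And>s. s \<in> I \<Longrightarrow> \<langle>binormal F s, binormal F s\<rangle> = \<epsilon>B"
    and "\<And>s. s \<in> I \<Longrightarrow> binormal F s = (\<epsilon>T * \<epsilon>N) *\<^sub>R (tangent F s \<times>\<^sub>L normal F s)"
  with s have BB: "\<langle>binormal F s, binormal F s\<rangle> = \<epsilon>B"
    and B: "binormal F s = (\<epsilon>T * \<epsilon>N) *\<^sub>R (tangent F s \<times>\<^sub>L normal F s)"
    by auto
  have "\<langle>tangent F s \<times>\<^sub>L normal F s, binormal F s\<rangle> \<noteq> 0"
  proof
    assume "\<langle>tangent F s \<times>\<^sub>L normal F s, binormal F s\<rangle> = 0"
    then have "\<langle>binormal F s, binormal F s\<rangle> = 0"
      by (subst (1) B) (simp add: minkowski.scaleR_left)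
    with BB \<epsilon> show False by auto
  qed
  with triple_product_expansion[of "tangent F s" "normal F s" "binormal F s" U] orth
  show ?thesis by (simp add: minkowski_inner_commute[of U])
qed

section \<open>Differentiation on a nondegenerate interval and uniqueness of the apparatus\<close>

context
  fixes I :: "real set"
  assumes interval: "is_interval I" and nontrivial: "interior I \<noteq> {}"
begin

text \<open>A connected set that is not a singleton has no isolated points, so even one-sided
  derivatives at endpoints are unique.\<close>

lemma at_within_interval_neq_bot:
  assumes "s \<in> I"
  shows "at s within I \<noteq> bot"
proof -
  have "\<nexists>a. I = {a}"
    using nontrivial by auto
  then show ?thesis
    using assms connected_imp_perfect[of I s] interval
    by (auto simp: is_interval_connected_1 trivial_limit_within)
qed

lemma vector_derivative_within_interval_unique:
  fixes f g :: "real \<Rightarrow> 'a::real_normed_vector"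
  assumes f: "(f has_vector_derivative f') (at s within I)"
    and g: "(g has_vector_derivative g') (at s within I)"
    and s: "s \<in> I" and eq: "\<And>t. t \<in> I \<Longrightarrow> f t = g t"
  shows "f' = g'"
proof -
  have "(f has_vector_derivative g') (at s within I)"
    using s eq g by (rule has_vector_derivative_transform)
  with f at_within_interval_neq_bot[OF s] show ?thesis
    using vector_derivative_unique_within by blast
qed

lemma zero_vector_derivative_imp_constant:
  fixes f :: "real \<Rightarrow> 'a::real_normed_vector"
  assumes "\<And>s. s \<in> I \<Longrightarrow> (f has_vector_derivative 0) (at s within I)"
  shows "\<exists>c. \<forall>s\<in>I. f s = c"
  using has_vector_derivative_zero_constant[of I f] assms interval
  by (metis is_interval_convex)

text \<open>Both frames share the tangent, so comparing its derivatives makes the normals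
  proportional. Unit length makes the factor a sign at each point, and connectedness makes it the
  same sign everywhere.\<close>

lemma frenet_apparatus_unique_up_to_sign:
  assumes F: "is_frenet_apparatus I \<alpha> F" and F': "is_frenet_apparatus I \<alpha> F'"
  obtains \<sigma> :: real where "\<And>s. s \<in> I \<Longrightarrow> normal F' s = \<sigma> *\<^sub>R normal F s"
    "\<And>s. s \<in> I \<Longrightarrow> binormal F' s = \<sigma> *\<^sub>R binormal F s"
proof (rule frenet_apparatus_elim[OF F], rule frenet_apparatus_elim[OF F'])
  fix \<epsilon>T \<epsilon>N \<epsilon>B \<epsilon>T' \<epsilon>N' \<epsilon>B' :: real
  assume \<epsilon>: "\<epsilon>N \<in> {1, -1}" "\<epsilon>N' \<in> {1, -1}"
    and TT: "\<And>s. s \<in> I \<Longrightarrow> \<langle>tangent F s, tangent F s\<rangle> = \<epsilon>T"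
      "\<And>s. s \<in> I \<Longrightarrow> \<langle>tangent F' s, tangent F' s\<rangle> = \<epsilon>T'"
    and NN: "\<And>s. s \<in> I \<Longrightarrow> \<langle>normal F s, normal F s\<rangle> = \<epsilon>N"
      "\<And>s. s \<in> I \<Longrightarrow> \<langle>normal F' s, normal F' s\<rangle> = \<epsilon>N'"
    and B: "\<And>s. s \<in> I \<Longrightarrow> binormal F s = (\<epsilon>T * \<epsilon>N) *\<^sub>R (tangent F s \<times>\<^sub>L normal F s)"
      "\<And>s. s \<in> I \<Longrightarrow> binormal F' s = (\<epsilon>T' * \<epsilon>N') *\<^sub>R (tangent F' s \<times>\<^sub>L normal F' s)"
    and d\<alpha>: "\<And>s. s \<in> I \<Longrightarrow> (\<alpha> has_vector_derivative tangent F s) (at s within I)"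
      "\<And>s. s \<in> I \<Longrightarrow> (\<alpha> has_vector_derivative tangent F' s) (at s within I)"
    and dT: "\<And>s. s \<in> I \<Longrightarrow>
        (tangent F has_vector_derivative curvature F s *\<^sub>R normal F s) (at s within I)"
      "\<And>s. s \<in> I \<Longrightarrow>
        (tangent F' has_vector_derivative curvature F' s *\<^sub>R normal F' s) (at s within I)"
    and dN: "\<And>s. s \<in> I \<Longrightarrow> (normal F has_vector_derivative
        (\<epsilon>B * curvature F s) *\<^sub>R tangent F s + torsion F s *\<^sub>R binormal F s) (at s within I)"
      "\<And>s. s \<in> I \<Longrightarrow> (normal F' has_vector_derivative
        (\<epsilon>B' * curvature F' s) *\<^sub>R tangent F' s + torsion F' s *\<^sub>R binormal F' s) (at s within I)"
    and \<kappa>: "\<And>s. s \<in> I \<Longrightarrow> curvature F' s \<noteq> 0"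
  have T_eq: "tangent F' s = tangent F s" if "s \<in> I" for s
    using vector_derivative_within_interval_unique[OF d\<alpha>(2) d\<alpha>(1)] that by simp
  obtain s0 where s0: "s0 \<in> I"
    using nontrivial interior_subset by blast
  define \<rho> where "\<rho> s = curvature F s / curvature F' s" for s
  have N_eq: "normal F' s = \<rho> s *\<^sub>R normal F s" if s: "s \<in> I" for s
  proof -
    have "curvature F' s *\<^sub>R normal F' s = curvature F s *\<^sub>R normal F s"
      using vector_derivative_within_interval_unique[OF dT(2) dT(1)] T_eq s by simp
    then have "normal F' s = inverse (curvature F' s) *\<^sub>R (curvature F s *\<^sub>R normal F s)"
      using \<kappa>[OF s] by (metis scaleR_scaleR left_inverse scaleR_one)
    then show ?thesis by (simp add: \<rho>_def divide_inverse mult.commute)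
  qed
  have \<epsilon>_eq: "\<epsilon>N' = (\<rho> s)\<^sup>2 * \<epsilon>N" if "s \<in> I" for s
    using NN[OF that] N_eq[OF that]
    by (simp add: minkowski.scaleR_left minkowski.scaleR_right power2_eq_square)
  have "\<epsilon>N' = \<epsilon>N" and \<rho>_sq: "(\<rho> s)\<^sup>2 = 1" if "s \<in> I" for s
  proof -
    \<comment> \<open>Both causal signs are 1 or -1, so the square of \<open>\<rho> s\<close> is
      too; ruling out -1 also shows that the two normals have the same causal character.\<close>
    have "(\<rho> s)\<^sup>2 \<noteq> - 1"
      using zero_le_power2[of "\<rho> s"] by linarith
    then show "\<epsilon>N' = \<epsilon>N" "(\<rho> s)\<^sup>2 = 1"
      using \<epsilon>_eq[OF that] \<epsilon> by auto
  qed
  with s0 have \<epsilon>N_eq: "\<epsilon>N' = \<epsilon>N" by blast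
  \<comment> \<open>Curvatures are not assumed continuous, so continuity of their quotient
    \<open>\<rho>\<close> is read off from the differentiable normals instead.\<close>
  have \<rho>_inner: "\<rho> s = \<epsilon>N * \<langle>normal F s, normal F' s\<rangle>" if "s \<in> I" for s
    using NN(1)[OF that] N_eq[OF that] \<epsilon> by (auto simp: minkowski.scaleR_right)
  have "continuous_on I (\<lambda>s. \<epsilon>N * \<langle>normal F s, normal F' s\<rangle>)"
    using dN by (intro continuous_intros minkowski.continuous_on)
      (auto intro: has_vector_derivative_continuous simp: continuous_on_eq_continuous_within)
  then have "continuous_on I \<rho>"
    using \<rho>_inner by (simp cong: continuous_on_cong)
  moreover have "finite (\<rho> ` I)"
  proof (rule finite_subset)
    show "\<rho> ` I \<subseteq> {1, -1}"
      using \<rho>_sq by (auto simp: power2_eq_1_iff)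
  qed simp
  ultimately have "\<rho> constant_on I"
    using interval continuous_finite_range_constant[of I \<rho>]
    by (simp add: is_interval_connected_1)
  then obtain \<sigma> where \<sigma>: "\<And>s. s \<in> I \<Longrightarrow> \<rho> s = \<sigma>"
    unfolding constant_on_def by blast
  show thesis
  proof
    fix s assume s: "s \<in> I"
    show N_s: "normal F' s = \<sigma> *\<^sub>R normal F s"
      using N_eq \<sigma> s by simp
    have "\<epsilon>T' = \<epsilon>T"
      using TT T_eq s by metis
    then show "binormal F' s = \<sigma> *\<^sub>R binormal F s"
      using B[OF s] T_eq[OF s] N_s \<epsilon>N_eq by (simp add: lorentz_cross_scaleR_right mult.commute)
  qed
qed

section \<open>Torsion, helices and fixed directions\<close>

lemma torsion_nonzero_if_binormal_is_normal:
  assumes F: "is_frenet_apparatus I \<alpha> F" and G: "is_frenet_apparatus I \<beta> G"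
    and NB: "\<And>s. s \<in> I \<Longrightarrow> normal G s = binormal F s" and s: "s \<in> I"
  shows "torsion F s \<noteq> 0"
proof (rule frenet_apparatus_elim[OF F], rule frenet_apparatus_elim[OF G], rule notI)
  fix \<epsilon>T \<delta>T \<delta>B :: real
  assume 0: "torsion F s = 0" and \<delta>: "\<delta>T \<in> {1, -1}" "\<delta>B \<in> {1, -1}"
    and dB: "\<And>s. s \<in> I \<Longrightarrow>
        (binormal F has_vector_derivative (\<epsilon>T * torsion F s) *\<^sub>R normal F s) (at s within I)"
    and TT: "\<And>s. s \<in> I \<Longrightarrow> \<langle>tangent G s, tangent G s\<rangle> = \<delta>T"
    and TB: "\<And>s. s \<in> I \<Longrightarrow> \<langle>tangent G s, binormal G s\<rangle> = 0"
    and dN: "\<And>s. s \<in> I \<Longrightarrow> (normal G has_vector_derivative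
        (\<delta>B * curvature G s) *\<^sub>R tangent G s + torsion G s *\<^sub>R binormal G s) (at s within I)"
    and \<kappa>: "\<And>s. s \<in> I \<Longrightarrow> curvature G s \<noteq> 0"
  have "(\<delta>B * curvature G s) *\<^sub>R tangent G s + torsion G s *\<^sub>R binormal G s = 0"
    using vector_derivative_within_interval_unique[OF dN[OF s] dB[OF s] s NB] 0 by simp
  \<comment> \<open>Pairing with the tangent isolates the curvature of \<beta>, up to sign.\<close>
  then have "\<langle>tangent G s, (\<delta>B * curvature G s) *\<^sub>R tangent G s + torsion G s *\<^sub>R binormal G s\<rangle> = 0"
    by (simp add: minkowski.zero_right)
  then show False
    using TT[OF s] TB[OF s] \<delta> \<kappa>[OF s] by (auto simp: minkowski.add_right minkowski.scaleR_right)
qed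

lemma constant_curvature_ratio_imp_fixed_direction:
  assumes F: "is_frenet_apparatus I \<alpha> F"
    and \<tau>: "\<And>s. s \<in> I \<Longrightarrow> torsion F s \<noteq> 0"
    and c: "\<And>s. s \<in> I \<Longrightarrow> curvature F s / torsion F s = c"
  shows "\<exists>U. U \<noteq> 0 \<and> (\<exists>d. \<forall>s\<in>I. \<langle>binormal F s, U\<rangle> = d)"
proof (rule frenet_apparatus_elim[OF F])
  fix \<epsilon>T \<epsilon>B :: real
  assume \<epsilon>: "\<epsilon>B \<in> {1, -1}"
    and BB: "\<And>s. s \<in> I \<Longrightarrow> \<langle>binormal F s, binormal F s\<rangle> = \<epsilon>B"
    and TB: "\<And>s. s \<in> I \<Longrightarrow> \<langle>tangent F s, binormal F s\<rangle> = 0"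
    and dT: "\<And>s. s \<in> I \<Longrightarrow>
        (tangent F has_vector_derivative curvature F s *\<^sub>R normal F s) (at s within I)"
    and dB: "\<And>s. s \<in> I \<Longrightarrow>
        (binormal F has_vector_derivative (\<epsilon>T * torsion F s) *\<^sub>R normal F s) (at s within I)"
    and \<kappa>: "\<And>s. s \<in> I \<Longrightarrow> curvature F s \<noteq> 0"
  obtain s0 where s0: "s0 \<in> I"
    using nontrivial interior_subset by blast
  have "c \<noteq> 0"
    using c[OF s0] \<kappa>[OF s0] \<tau>[OF s0] by auto
  \<comment> \<open>Both derivatives are multiples of the normal; since the curvature is
    \<open>c\<close> times the torsion, this coefficient makes them cancel.\<close>
  let ?V = "\<lambda>s. binormal F s - (\<epsilon>T / c) *\<^sub>R tangent F s"
  have "(?V has_vector_derivative 0) (at s within I)" if s: "s \<in> I" for s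
  proof -
    have "curvature F s = c * torsion F s"
      using c[OF s] \<tau>[OF s] by (simp add: field_simps)
    then have "(\<epsilon>T * torsion F s) *\<^sub>R normal F s - (\<epsilon>T / c) *\<^sub>R curvature F s *\<^sub>R normal F s = 0"
      using \<open>c \<noteq> 0\<close> by simp
    then show ?thesis
      using has_vector_derivative_diff[OF dB[OF s] bounded_linear.has_vector_derivative[OF
          bounded_linear_scaleR_right dT[OF s]], of "\<epsilon>T / c"] by metis
  qed
  then obtain U where U: "\<And>s. s \<in> I \<Longrightarrow> ?V s = U"
    using zero_vector_derivative_imp_constant[of ?V] by blast
  have "\<langle>binormal F s, U\<rangle> = \<epsilon>B" if "s \<in> I" for s
    using U[OF that, symmetric] BB[OF that] TB[OF that]
    by (simp add: minkowski.diff_right minkowski.scaleR_right minkowski_inner_commute)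
  moreover from this[OF s0] have "U \<noteq> 0"
    using \<epsilon> by (auto simp: minkowski.zero_right)
  ultimately show ?thesis by blast
qed

text \<open>Each Frenet equation is paired with \<open>U\<close> in turn: the one for
  \<open>B\<close> gives orthogonality of \<open>N\<close> and \<open>U\<close>, the one for
  \<open>T\<close> a constant product with \<open>T\<close>, and the one for \<open>N\<close> a
  linear relation between curvature and torsion.\<close>

lemma fixed_direction_imp_constant_curvature_ratio:
  assumes F: "is_frenet_apparatus I \<alpha> F"
    and \<tau>: "\<And>s. s \<in> I \<Longrightarrow> torsion F s \<noteq> 0"
    and U: "U \<noteq> 0" and d: "\<And>s. s \<in> I \<Longrightarrow> \<langle>binormal F s, U\<rangle> = d"
  shows "\<exists>c. \<forall>s\<in>I. curvature F s / torsion F s = c"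
proof (rule frenet_apparatus_elim[OF F])
  fix \<epsilon>T \<epsilon>B :: real
  assume \<epsilon>: "\<epsilon>T \<in> {1, -1}" "\<epsilon>B \<in> {1, -1}"
    and dT: "\<And>s. s \<in> I \<Longrightarrow>
        (tangent F has_vector_derivative curvature F s *\<^sub>R normal F s) (at s within I)"
    and dN: "\<And>s. s \<in> I \<Longrightarrow> (normal F has_vector_derivative
        (\<epsilon>B * curvature F s) *\<^sub>R tangent F s + torsion F s *\<^sub>R binormal F s) (at s within I)"
    and dB: "\<And>s. s \<in> I \<Longrightarrow>
        (binormal F has_vector_derivative (\<epsilon>T * torsion F s) *\<^sub>R normal F s) (at s within I)"
  note inner_U = bounded_linear.has_vector_derivative[OF minkowski.bounded_linear_left, of _ _ _ U]
  have NU: "\<langle>normal F s, U\<rangle> = 0" if s: "s \<in> I" for s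
  proof -
    have "\<langle>(\<epsilon>T * torsion F s) *\<^sub>R normal F s, U\<rangle> = 0"
      by (rule vector_derivative_within_interval_unique[OF
            inner_U[OF dB[OF s]] has_vector_derivative_const s d])
    then show ?thesis
      using \<tau>[OF s] \<epsilon> by (auto simp: minkowski.scaleR_left)
  qed
  have "((\<lambda>s. \<langle>tangent F s, U\<rangle>) has_vector_derivative 0) (at s within I)" if s: "s \<in> I" for s
    using inner_U[OF dT[OF s]] NU[OF s] by (simp add: minkowski.scaleR_left)
  then obtain a where a: "\<And>s. s \<in> I \<Longrightarrow> \<langle>tangent F s, U\<rangle> = a"
    using zero_vector_derivative_imp_constant[of "\<lambda>s. \<langle>tangent F s, U\<rangle>"] by blast
  have "curvature F s / torsion F s = - d / (\<epsilon>B * a)" if s: "s \<in> I" for s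
  proof -
    have "\<langle>(\<epsilon>B * curvature F s) *\<^sub>R tangent F s + torsion F s *\<^sub>R binormal F s, U\<rangle> = 0"
      by (rule vector_derivative_within_interval_unique[OF
            inner_U[OF dN[OF s]] has_vector_derivative_const s NU])
    then have eq: "\<epsilon>B * curvature F s * a + torsion F s * d = 0"
      using a[OF s] d[OF s] by (simp add: minkowski.add_left minkowski.scaleR_left)
    \<comment> \<open>If \<open>a\<close> vanished, the relation would force \<open>d = 0\<close>,
      and \<open>U\<close> would be orthogonal to the whole frame. So the claimed ratio is a genuine
      quotient.\<close>
    have "a \<noteq> 0"
    proof
      assume "a = 0"
      then have "d = 0" using eq \<tau>[OF s] by simp
      with \<open>a = 0\<close> show False
        using frenet_frame_orthogonal_imp_0[OF F s] a[OF s] d[OF s] NU[OF s] U by simp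
    qed
    then show ?thesis
      using eq \<tau>[OF s] \<epsilon> by (auto simp: field_simps)
  qed
  then show ?thesis by blast
qed

text \<open>The helix and slant conditions may be witnessed by apparatuses other than the pair with
  \<open>normal G s = binormal F s\<close>; uniqueness up to sign carries a constant product with
  \<open>U\<close> from one to the other.\<close>

lemma helix_iff_mannheim_direction_curve_slant_helix:
  assumes "mannheim_direction_curve I \<alpha> \<beta>"
  shows "general_helix I \<alpha> \<longleftrightarrow> slant_helix I \<beta>"
proof -
  obtain F G where \<alpha>: "frenet_curve I \<alpha>" and \<beta>: "frenet_curve I \<beta>"
    and F: "is_frenet_apparatus I \<alpha> F" and G: "is_frenet_apparatus I \<beta> G"
    and NB: "\<And>s. s \<in> I \<Longrightarrow> normal G s = binormal F s"
    using assms unfolding mannheim_direction_curve_def by blast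
  have \<tau>: "torsion F s \<noteq> 0" if "s \<in> I" for s
    using torsion_nonzero_if_binormal_is_normal[OF F G NB that] .
  show ?thesis
  proof
    assume "general_helix I \<alpha>"
    then obtain F' c where F': "is_frenet_apparatus I \<alpha> F'"
      and \<tau>': "\<And>s. s \<in> I \<Longrightarrow> torsion F' s \<noteq> 0"
      and c: "\<And>s. s \<in> I \<Longrightarrow> curvature F' s / torsion F' s = c"
      unfolding general_helix_def by blast
    obtain U d where U: "U \<noteq> 0" and d: "\<And>s. s \<in> I \<Longrightarrow> \<langle>binormal F' s, U\<rangle> = d"
      using constant_curvature_ratio_imp_fixed_direction[OF F' \<tau>' c] by blast
    obtain \<sigma> where "\<And>s. s \<in> I \<Longrightarrow> binormal F s = \<sigma> *\<^sub>R binormal F' s"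
      using frenet_apparatus_unique_up_to_sign[OF F' F] by blast
    then have "\<forall>s\<in>I. \<langle>normal G s, U\<rangle> = \<sigma> * d"
      using NB d by (simp add: minkowski.scaleR_left)
    then show "slant_helix I \<beta>"
      using \<beta> G U unfolding slant_helix_def by blast
  next
    assume "slant_helix I \<beta>"
    then obtain G' U d where G': "is_frenet_apparatus I \<beta> G'" and U: "U \<noteq> 0"
      and d: "\<And>s. s \<in> I \<Longrightarrow> \<langle>normal G' s, U\<rangle> = d"
      unfolding slant_helix_def by blast
    obtain \<sigma> where "\<And>s. s \<in> I \<Longrightarrow> normal G s = \<sigma> *\<^sub>R normal G' s"
      using frenet_apparatus_unique_up_to_sign[OF G' G] by blast
    then have "\<langle>binormal F s, U\<rangle> = \<sigma> * d" if "s \<in> I" for s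
      using NB d that by (metis minkowski.scaleR_left real_scaleR_def)
    then have "\<exists>c. \<forall>s\<in>I. curvature F s / torsion F s = c"
      using fixed_direction_imp_constant_curvature_ratio[OF F \<tau> U] by blast
    then show "general_helix I \<alpha>"
      using \<alpha> F \<tau> unfolding general_helix_def by blast
  qed
qed

end

theorem theorem4p3:
  fixes I :: "real set" and \<alpha> \<beta> :: "real \<Rightarrow> real^3"
  assumes "is_interval I" and "interior I \<noteq> {}"
    and "non_lightlike_curve I \<alpha>" and "unit_speed_curve I \<alpha>" and "frenet_curve I \<alpha>"
    and "mannheim_direction_curve I \<alpha> \<beta>"
  shows "(general_helix I \<alpha> \<longleftrightarrow> (\<exists>\<gamma>. slant_helix I \<gamma> \<and> mannheim_donor_curve I \<gamma> \<alpha>)) \<and>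
    (general_helix I \<alpha> \<longleftrightarrow> slant_helix I \<beta>)"
  \<comment> \<open>The equivalence holds for every Mannheim-direction curve, so any \<gamma> as in
    (ii) makes \<alpha> a helix, and \<beta> itself serves as \<gamma> in the converse.\<close>
  using helix_iff_mannheim_direction_curve_slant_helix[OF assms(1,2)] assms(6)
  unfolding mannheim_donor_curve_def by blast

end
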